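(* Let $G$ be a bridgeless cubic graph. Then there exist five perfect matchings $M_1,\ldots,M_5$ of $G$ such that $$\left|\bigcup_{i=1}^5 M_i\right|\ \ge\ \left\lceil \frac{215}{231}\,|E(G)|\right\rceil .$$
   Context: All graphs are finite, simple (no loops, no parallel edges) and connected. A graph is cubic if every vertex has degree 3, and bridgeless if the removal of any single edge leaves it connected. $E(G)$ is the edge-set of $G$. A perfect matching of $G$ is a $1$-regular spanning subgraph of $G$, identified with its set of edges. The perfect matchings $M_1,\ldots,M_5$ are not required to be distinct. *)

theory Defs
  imports Complex_Main
begin

text \<open>
  A graph is given by its vertex set and its set of edges, an edge being the two-element set of
  its endpoints; hence there are no loops and no parallel edges.
\<close>

definition simple_graph :: "'a set \<Rightarrow> 'a set set \<Rightarrow> bool" where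
  "simple_graph V E \<longleftrightarrow> finite V \<and> (\<forall>e\<in>E. e \<subseteq> V \<and> card e = 2)"

definition adjacency :: "'a set set \<Rightarrow> ('a \<times> 'a) set" where
  "adjacency E = {(u, v). {u, v} \<in> E}"

definition connected_graph :: "'a set \<Rightarrow> 'a set set \<Rightarrow> bool" where
  "connected_graph V E \<longleftrightarrow> V \<noteq> {} \<and> (\<forall>u\<in>V. \<forall>v\<in>V. (u, v) \<in> (adjacency E)\<^sup>*)"

definition degree :: "'a set set \<Rightarrow> 'a \<Rightarrow> nat" where
  "degree E v = card {e \<in> E. v \<in> e}"

definition regular_graph :: "nat \<Rightarrow> 'a set \<Rightarrow> 'a set set \<Rightarrow> bool" where
  "regular_graph k V E \<longleftrightarrow> (\<forall>v\<in>V. degree E v = k)"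

abbreviation cubic_graph :: "'a set \<Rightarrow> 'a set set \<Rightarrow> bool" where
  "cubic_graph \<equiv> regular_graph 3"

definition bridgeless :: "'a set \<Rightarrow> 'a set set \<Rightarrow> bool" where
  "bridgeless V E \<longleftrightarrow> (\<forall>e\<in>E. connected_graph V (E - {e}))"

text \<open>
  A spanning subgraph of \<open>(V, E)\<close> has vertex set \<open>V\<close>, so it is identified with its edge set
  \<open>M \<subseteq> E\<close>.
\<close>

definition perfect_matching :: "'a set \<Rightarrow> 'a set set \<Rightarrow> 'a set set \<Rightarrow> bool" where
  "perfect_matching V E M \<longleftrightarrow> M \<subseteq> E \<and> regular_graph 1 V M"

end

theory Submission
  imports Defs "HOL-Library.FuncSet"
begin

text \<open>
  The matchings are chosen one after another, following Kaiser, Kral and Norine, and the tool for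
  choosing the next one is Edmonds' perfect matching polytope theorem: if nonnegative edge weights
  \<open>w\<close> add up to one at every vertex and to at least one over every odd cut, then for every cost
  \<open>c\<close> some perfect matching costs at least \<open>\<Sum>e\<in>E. c e * w e\<close>. A large penalty on superfluous
  crossings makes this matching also cross every odd cut of weight exactly one only once
  (\<open>perfect_matching_on_tight_cuts\<close>).

  Suppose that \<open>k\<close> perfect matchings are given and let \<open>n e\<close> be the number of those that contain
  \<open>e\<close>. The weights \<open>w e = (k + 1 - n e) / (2 * k + 3)\<close> add up to one at every vertex of a cubic
  graph. An odd cut \<open>C\<close> has weight at least one if and only if its slack, that is
  \<open>(k + 1) * card C\<close> minus \<open>2 * k + 3\<close> and minus the number of crossings of \<open>C\<close> by the matchings,
  is nonnegative. A further matching \<open>N\<close> changes the slack by \<open>card C - card (N \<inter> C) - 2\<close>. The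
  slack is even, because \<open>C\<close> and its intersections with perfect matchings have odd size. Hence a
  positive slack is at least two and stays nonnegative. If the slack is zero, then \<open>C\<close> has weight
  one, \<open>N\<close> crosses it once, and the new slack is \<open>card C - 3\<close>, which is nonnegative because there
  is no bridge. So the construction never stops (\<open>greedy_perfect_matchings\<close>). An uncovered edge has
  weight \<open>(k + 1) / (2 * k + 3)\<close>, and with the indicator of the uncovered edges as cost, \<open>N\<close> covers
  at least this fraction of them. After five steps the uncovered fraction is at most
  \<open>2/3 * 3/5 * 4/7 * 5/9 * 6/11 = 16/231\<close>.

  Edmonds' theorem is proved in complete graphs (\<open>pairings_dominate_fractional_pairings\<close>) by
  induction on the number of vertices. If some odd set is tight and not trivial, both of its sides
  are contracted, and the optimal pairings of the two smaller instances are glued along a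
  well-chosen edge of the cut (\<open>pairing_of_tight_cut\<close>). A vertex with at most two edges in the
  support lies in such a tight set of three vertices. If there is no such vertex, the support has
  more edges than there are vertices, so the degree equations leave a direction in which to move
  without decreasing the cost, until the support shrinks or a set becomes tight.
\<close>

section \<open>Sums over the edges at a vertex\<close>

lemma simple_graphD:
  assumes "simple_graph V E"
  shows "finite V" "finite E" "e \<in> E \<Longrightarrow> e \<subseteq> V" "e \<in> E \<Longrightarrow> card e = 2" "{u} \<notin> E"
proof -
  show "finite V" "e \<in> E \<Longrightarrow> e \<subseteq> V" "e \<in> E \<Longrightarrow> card e = 2"
    using assms by (auto simp: simple_graph_def)
  have "E \<subseteq> Pow V" using assms by (auto simp: simple_graph_def)
  then show "finite E" using \<open>finite V\<close> by (meson finite_Pow_iff finite_subset)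
  have "card {u} \<noteq> 2" by simp
  then show "{u} \<notin> E" using assms unfolding simple_graph_def by blast
qed

lemma weighted_handshake:
  fixes f :: "'a set \<Rightarrow> 'b :: comm_semiring_1"
  assumes "finite U" "finite E"
  shows "(\<Sum>v\<in>U. \<Sum>e | e \<in> E \<and> v \<in> e. f e) = (\<Sum>e\<in>E. of_nat (card (e \<inter> U)) * f e)"
proof -
  have "(\<Sum>v\<in>U. \<Sum>e | e \<in> E \<and> v \<in> e. f e) = (\<Sum>e\<in>E. \<Sum>v | v \<in> U \<and> v \<in> e. f e)"
    using assms by (rule sum.swap_restrict)
  moreover have "{v. v \<in> U \<and> v \<in> e} = e \<inter> U" for e by blast
  ultimately show ?thesis by simp
qed

text \<open>
  The bridge between edges as two-element sets and symmetric functions of two vertices.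
\<close>

lemma sum_over_neighbours:
  assumes G: "simple_graph V E" and u: "u \<in> V"
  shows "(\<Sum>v\<in>V. if {u, v} \<in> E then f {u, v} else 0) = (\<Sum>e | e \<in> E \<and> u \<in> e. f e)"
proof -
  have "(\<Sum>v\<in>V. if {u, v} \<in> E then f {u, v} else 0) = (\<Sum>v | v \<in> V \<and> {u, v} \<in> E. f {u, v})"
    using simple_graphD(1)[OF G] by (simp add: sum.inter_filter)
  also have "\<dots> = (\<Sum>e\<in>(\<lambda>v. {u, v}) ` {v \<in> V. {u, v} \<in> E}. f e)"
    by (subst sum.reindex) (auto simp: inj_on_def doubleton_eq_iff)
  also have "(\<lambda>v. {u, v}) ` {v \<in> V. {u, v} \<in> E} = {e. e \<in> E \<and> u \<in> e}"
  proof (intro equalityI subsetI)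
    fix e assume e: "e \<in> {e. e \<in> E \<and> u \<in> e}"
    then have "card e = 2" "e \<subseteq> V" using simple_graphD(3,4)[OF G] by auto
    then show "e \<in> (\<lambda>v. {u, v}) ` {v \<in> V. {u, v} \<in> E}" using e
      by (auto simp: card_2_iff insert_commute)
  qed auto
  finally show ?thesis .
qed

section \<open>Pairings and fractional pairings\<close>

text \<open>
  A perfect matching of the complete graph on \<open>V\<close>, as the involution that sends each vertex to
  its partner. The cost of a pairing is then the sum of \<open>c v (m v)\<close> over all vertices, which counts
  every pair twice, just as a double sum over vertices counts every edge twice. Working in the
  complete graph keeps the class of instances closed under contraction: parallel edges merge by
  adding their weights.
\<close>

definition pairing :: "'a set \<Rightarrow> ('a \<Rightarrow> 'a) \<Rightarrow> bool" where
  "pairing V m \<longleftrightarrow> (\<forall>v\<in>V. m v \<in> V \<and> m v \<noteq> v \<and> m (m v) = v)"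

lemma pairing_Un:
  assumes "pairing A m" "pairing B n" "A \<inter> B = {}"
  shows "pairing (A \<union> B) (\<lambda>v. if v \<in> A then m v else n v)"
  using assms unfolding pairing_def by auto

lemma pairing_transposition:
  assumes "a \<noteq> b"
  shows "pairing {a, b} (\<lambda>v. if v = a then b else a)"
  using assms unfolding pairing_def by auto

lemma pairing_exists:
  assumes "finite V" "even (card V)"
  shows "\<exists>m. pairing V m"
  using assms
proof (induction "card V" arbitrary: V rule: less_induct)
  case less
  show ?case
  proof (cases "V = {}")
    case True
    then show ?thesis by (auto simp: pairing_def)
  next
    case False
    then have "card V \<noteq> 0" using less.prems by simp
    then have "2 \<le> card V" using less.prems(2) by (cases "card V = 1") auto
    then obtain P where P: "P \<subseteq> V" "card P = 2" "finite P"
      using obtain_subset_with_card_n by metis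
    then obtain a b where ab: "P = {a, b}" "a \<noteq> b" by (auto simp: card_2_iff)
    have "card (V - P) = card V - 2" using P less.prems by (simp add: card_Diff_subset)
    then obtain m where "pairing (V - P) m"
      using less.hyps[of "V - P"] less.prems \<open>2 \<le> card V\<close> by auto
    then have "\<exists>n. pairing ((V - P) \<union> P) n"
      using pairing_Un[of "V - P" m P] pairing_transposition[OF ab(2)] ab(1) by blast
    then show ?thesis using P(1) by (simp add: Un_absorb2)
  qed
qed

lemma finite_pairing_costs:
  assumes "finite V"
  shows "finite {\<Sum>v\<in>V. c v (m v) | m. pairing V m}"
proof (rule finite_subset)
  show "finite ((\<lambda>m. \<Sum>v\<in>V. c v (m v)) ` (V \<rightarrow>\<^sub>E V))"
    using assms by (simp add: finite_PiE)
  show "{\<Sum>v\<in>V. c v (m v) | m. pairing V m} \<subseteq> (\<lambda>m. \<Sum>v\<in>V. c v (m v)) ` (V \<rightarrow>\<^sub>E V)"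
  proof safe
    fix m assume "pairing V m"
    then have "restrict m V \<in> V \<rightarrow>\<^sub>E V" by (auto simp: pairing_def)
    moreover have "(\<Sum>v\<in>V. c v (m v)) = (\<Sum>v\<in>V. c v (restrict m V v))" by simp
    ultimately show "(\<Sum>v\<in>V. c v (m v)) \<in> (\<lambda>m. \<Sum>v\<in>V. c v (m v)) ` (V \<rightarrow>\<^sub>E V)"
      by blast
  qed
qed

definition outflow :: "('a \<Rightarrow> 'a \<Rightarrow> real) \<Rightarrow> 'a set \<Rightarrow> 'a set \<Rightarrow> real" where
  "outflow x V U = (\<Sum>u\<in>U. \<Sum>v\<in>V - U. x u v)"

text \<open>
  Edmonds' description of the perfect matching polytope, for the complete graph on \<open>V\<close>.
\<close>

definition fractional_pairing :: "'a set \<Rightarrow> ('a \<Rightarrow> 'a \<Rightarrow> real) \<Rightarrow> bool" where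
  "fractional_pairing V x \<longleftrightarrow>
     (\<forall>u v. x u v = x v u) \<and>
     (\<forall>u\<in>V. \<forall>v\<in>V. 0 \<le> x u v) \<and>
     (\<forall>u\<in>V. x u u = 0) \<and>
     (\<forall>u\<in>V. (\<Sum>v\<in>V. x u v) = 1) \<and>
     (\<forall>U\<subseteq>V. odd (card U) \<longrightarrow> 1 \<le> outflow x V U)"

lemma fractional_pairingD:
  assumes "fractional_pairing V x"
  shows "x u v = x v u"
    and "u \<in> V \<Longrightarrow> v \<in> V \<Longrightarrow> 0 \<le> x u v"
    and "u \<in> V \<Longrightarrow> x u u = 0"
    and "u \<in> V \<Longrightarrow> (\<Sum>v\<in>V. x u v) = 1"
    and "U \<subseteq> V \<Longrightarrow> odd (card U) \<Longrightarrow> 1 \<le> outflow x V U"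
  using assms unfolding fractional_pairing_def by blast+

text \<open>
  For odd \<open>card V\<close> the cut constraint of \<open>V\<close> itself would say \<open>1 \<le> 0\<close>.
\<close>

lemma fractional_pairing_even:
  assumes "fractional_pairing V x"
  shows "even (card V)"
  using fractional_pairingD(5)[OF assms, of V] by (auto simp: outflow_def)

lemma outflow_singleton:
  assumes "finite V" "u \<in> V"
  shows "outflow x V {u} = (\<Sum>v\<in>V. x u v) - x u u"
  using assms by (simp add: outflow_def sum_diff1)

lemma outflow_complement:
  assumes "\<And>u v. x u v = x v u" "U \<subseteq> V"
  shows "outflow x V (V - U) = outflow x V U"
proof -
  have "V - (V - U) = U" using assms(2) by blast
  then have "outflow x V (V - U) = (\<Sum>u\<in>V - U. \<Sum>v\<in>U. x v u)"
    unfolding outflow_def using assms(1) by simp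
  also have "\<dots> = outflow x V U" unfolding outflow_def by (rule sum.swap)
  finally show ?thesis .
qed

section \<open>Gluing along a tight cut\<close>

text \<open>
  All vertices outside \<open>U\<close> are merged into a single one. Every vertex outside \<open>U\<close> may serve as
  the merged vertex, since the values do not depend on the choice.
\<close>

definition contract :: "('a \<Rightarrow> 'a \<Rightarrow> real) \<Rightarrow> 'a set \<Rightarrow> 'a set \<Rightarrow> 'a \<Rightarrow> 'a \<Rightarrow> real" where
  "contract x V U u v =
     (if u \<in> U then if v \<in> U then x u v else \<Sum>w\<in>V - U. x u w
      else if v \<in> U then \<Sum>w\<in>V - U. x v w else 0)"

text \<open>
  Tightness of \<open>U\<close> is the degree constraint of the merged vertex \<open>s\<close>. An odd set avoiding \<open>s\<close>
  has the same outflow before and after contraction, and an odd set containing \<open>s\<close> has the outflow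
  of its complement, which is odd and avoids \<open>s\<close>.
\<close>

lemma fractional_pairing_contract:
  assumes fin: "finite V" and x: "fractional_pairing V x"
    and U: "U \<subseteq> V" "odd (card U)" "outflow x V U = 1" and s: "s \<in> V - U"
  shows "fractional_pairing (insert s U) (contract x V U)"
proof -
  let ?x = "contract x V U" and ?V = "insert s U"
  note D = fractional_pairingD[OF x]
  have finU: "finite U" using U(1) fin by (rule finite_subset)
  have sU: "s \<notin> U" using s by blast
  have sym: "?x u v = ?x v u" for u v
    using D(1) by (auto simp: contract_def)
  have split: "(\<Sum>v\<in>?V - Z. ?x u v) = (\<Sum>v\<in>V - Z. x u v)" if "u \<in> U" "Z \<subseteq> U" for u Z
  proof -
    have "(\<Sum>v\<in>?V - Z. ?x u v) = (\<Sum>v\<in>insert s (U - Z). ?x u v)"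
      using that sU by (intro sum.cong) auto
    also have "\<dots> = (\<Sum>w\<in>V - U. x u w) + (\<Sum>v\<in>U - Z. x u v)"
      using that sU finU by (simp add: contract_def)
    also have "\<dots> = (\<Sum>v\<in>(V - U) \<union> (U - Z). x u v)"
      using fin finU by (intro sum.union_disjoint[symmetric]) auto
    also have "(V - U) \<union> (U - Z) = V - Z" using U(1) that by blast
    finally show ?thesis .
  qed
  have cut: "1 \<le> outflow ?x ?V Z" if Z: "Z \<subseteq> U" "odd (card Z)" for Z
  proof -
    have "outflow ?x ?V Z = outflow x V Z"
      unfolding outflow_def using split Z(1) by (intro sum.cong[OF refl]) auto
    then show ?thesis using D(5)[of Z] Z U(1) by auto
  qed
  show ?thesis
    unfolding fractional_pairing_def
  proof (intro conjI allI impI ballI)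
    fix u v show "?x u v = ?x v u" by (rule sym)
  next
    fix u v assume "u \<in> ?V" "v \<in> ?V"
    show "0 \<le> ?x u v"
      using U(1) D(2) by (auto simp: contract_def intro!: sum_nonneg)
  next
    fix u assume "u \<in> ?V"
    show "?x u u = 0"
      using U(1) D(3) by (auto simp: contract_def)
  next
    fix u assume u: "u \<in> ?V"
    show "(\<Sum>v\<in>?V. ?x u v) = 1"
    proof (cases "u = s")
      case True
      then have "(\<Sum>v\<in>?V. ?x u v) = (\<Sum>v\<in>U. \<Sum>w\<in>V - U. x v w)"
        using sU finU by (simp add: contract_def)
      then show ?thesis using U(3) by (simp add: outflow_def)
    next
      case False
      then show ?thesis using split[of u "{}"] D(4)[of u] u U(1) by auto
    qed
  next
    fix Z assume Z: "Z \<subseteq> ?V" "odd (card Z)"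
    show "1 \<le> outflow ?x ?V Z"
    proof (cases "s \<in> Z")
      case True
      have "card (?V - Z) = card ?V - card Z"
        using Z(1) finU by (intro card_Diff_subset) (auto intro: finite_subset)
      moreover have "card Z \<le> card ?V" using Z(1) finU by (intro card_mono) auto
      moreover have "card ?V = Suc (card U)" using sU finU by simp
      ultimately have "odd (card (?V - Z))" using Z(2) U(2) by auto
      moreover have "?V - Z \<subseteq> U" using True by blast
      ultimately have "1 \<le> outflow ?x ?V (?V - Z)" using cut by blast
      then show ?thesis using outflow_complement[OF sym Z(1)] by simp
    next
      case False
      then show ?thesis using Z cut by blast
    qed
  qed
qed

text \<open>
  Edmonds' theorem in its optimization form: over the fractional pairings, every linear cost is
  maximized by a pairing.
\<close>

definition pairings_dominate :: "'a set \<Rightarrow> bool" where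
  "pairings_dominate V \<longleftrightarrow> (\<forall>x (c :: 'a \<Rightarrow> 'a \<Rightarrow> real).
     fractional_pairing V x \<longrightarrow> (\<forall>u v. c u v = c v u) \<longrightarrow>
     (\<exists>m. pairing V m \<and> (\<Sum>u\<in>V. \<Sum>v\<in>V. c u v * x u v) \<le> (\<Sum>v\<in>V. c v (m v))))"

lemma pairings_dominateD:
  assumes "pairings_dominate V" "fractional_pairing V x" "\<And>u v. c u v = c v u"
  shows "\<exists>m. pairing V m \<and> (\<Sum>u\<in>V. \<Sum>v\<in>V. c u v * x u v) \<le> (\<Sum>v\<in>V. c v (m v))"
  using assms unfolding pairings_dominate_def by blast

text \<open>
  One side of the gluing argument. \<open>F u\<close> is the best cost of a pairing of \<open>U\<close> that leaves \<open>u\<close>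
  for the cut. Charging \<open>F u\<close> for the edge from \<open>u\<close> to the merged vertex makes the total cost of
  every pairing of the contracted instance at most zero. As pairings dominate there, the fractional
  cost is at most zero too, and this is the stated inequality.
\<close>

lemma inner_cost_le_exit_cost:
  fixes c :: "'a \<Rightarrow> 'a \<Rightarrow> real"
  assumes fin: "finite V" and x: "fractional_pairing V x"
    and U: "U \<subseteq> V" "odd (card U)" "outflow x V U = 1" and s: "s \<in> V - U"
    and c: "\<And>u v. c u v = c v u"
    and dom: "pairings_dominate (insert s U)"
  shows "\<exists>F. (\<forall>u\<in>U. \<exists>m. pairing (U - {u}) m \<and> (\<Sum>v\<in>U - {u}. c v (m v)) = F u) \<and>
    (\<Sum>u\<in>U. \<Sum>v\<in>U. c u v * x u v) \<le> (\<Sum>u\<in>U. \<Sum>w\<in>V - U. F u * x u w)"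
proof -
  define costs where "costs u = {\<Sum>v\<in>U - {u}. c v (m v) | m. pairing (U - {u}) m}" for u
  define F where "F u = Max (costs u)" for u
  have finU: "finite U" using U(1) fin by (rule finite_subset)
  have sU: "s \<notin> U" using s by blast
  have fincosts: "finite (costs u)" for u
    unfolding costs_def using finU by (intro finite_pairing_costs) auto
  have nonempty: "costs u \<noteq> {}" if "u \<in> U" for u
    using pairing_exists[of "U - {u}"] that U(2) finU by (auto simp: costs_def)
  have attained: "\<exists>m. pairing (U - {u}) m \<and> (\<Sum>v\<in>U - {u}. c v (m v)) = F u" if "u \<in> U" for u
    using Max_in[OF fincosts nonempty[OF that]] unfolding F_def costs_def by auto
  have best: "(\<Sum>v\<in>U - {u}. c v (m v)) \<le> F u" if "pairing (U - {u}) m" for u m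
    unfolding F_def using that fincosts by (intro Max_ge) (auto simp: costs_def)
  \<comment> \<open>Halved because the cost of a pairing counts the pair of \<open>u\<close> and \<open>s\<close> twice.\<close>
  define d where "d u v = (if u = s then - F v / 2 else if v = s then - F u / 2 else c u v)" for u v
  have d: "d u v = d v u" for u v using c by (auto simp: d_def)
  obtain m where m: "pairing (insert s U) m"
    and le: "(\<Sum>u\<in>insert s U. \<Sum>v\<in>insert s U. d u v * contract x V U u v) \<le>
      (\<Sum>v\<in>insert s U. d v (m v))"
    using pairings_dominateD[OF dom fractional_pairing_contract[OF fin x U s], of d] d by blast
  define u where "u = m s"
  have u: "u \<in> U" "m u = s" using m sU unfolding pairing_def u_def by auto
  have inner: "pairing (U - {u}) m"
    unfolding pairing_def
  proof
    fix v assume v: "v \<in> U - {u}"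
    then have "m v \<in> insert s U" "m v \<noteq> v" "m (m v) = v"
      using m unfolding pairing_def by auto
    moreover have "m v \<noteq> s" using v \<open>m (m v) = v\<close> by (auto simp: u_def)
    moreover have "m v \<noteq> u" using v sU u \<open>m (m v) = v\<close> by auto
    ultimately show "m v \<in> U - {u} \<and> m v \<noteq> v \<and> m (m v) = v" by blast
  qed
  have "(\<Sum>v\<in>U - {u}. c v (m v)) \<le> F u" using inner by (rule best)
  moreover have "(\<Sum>v\<in>U - {u}. d v (m v)) = (\<Sum>v\<in>U - {u}. c v (m v))"
    using inner sU by (intro sum.cong) (auto simp: d_def pairing_def)
  moreover have "(\<Sum>v\<in>insert s U. d v (m v)) = d s u + (d u s + (\<Sum>v\<in>U - {u}. d v (m v)))"
    using finU sU u by (simp add: u_def sum.remove[of U u])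
  ultimately have "(\<Sum>v\<in>insert s U. d v (m v)) \<le> 0"
    using sU u by (auto simp: d_def)
  with le have "(\<Sum>u\<in>insert s U. \<Sum>v\<in>insert s U. d u v * contract x V U u v) \<le> 0" by simp
  moreover have "(\<Sum>v\<in>insert s U. d u v * contract x V U u v) =
      (\<Sum>v\<in>U. c u v * x u v) - (\<Sum>w\<in>V - U. F u * x u w) / 2" if "u \<in> U" for u
  proof -
    have "(\<Sum>v\<in>U. d u v * contract x V U u v) = (\<Sum>v\<in>U. c u v * x u v)"
      using that sU by (intro sum.cong) (auto simp: d_def contract_def)
    then show ?thesis
      using that sU finU by (auto simp: d_def contract_def sum_distrib_left sum_negf sum_divide_distrib)
  qed
  moreover have "(\<Sum>v\<in>insert s U. d s v * contract x V U s v) =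
      - (\<Sum>u\<in>U. \<Sum>w\<in>V - U. F u * x u w) / 2"
    using sU finU by (simp add: d_def contract_def sum_distrib_left sum_negf sum_divide_distrib)
  ultimately have "(\<Sum>u\<in>U. \<Sum>v\<in>U. c u v * x u v) \<le> (\<Sum>u\<in>U. \<Sum>w\<in>V - U. F u * x u w)"
    using sU finU by (simp add: sum_subtractf sum_divide_distrib[symmetric])
  then show ?thesis using attained by blast
qed

lemma weighted_average_le_some_value:
  fixes w h :: "'a \<Rightarrow> real"
  assumes "finite P" "\<And>p. p \<in> P \<Longrightarrow> 0 \<le> w p" "(\<Sum>p\<in>P. w p) = 1"
  shows "\<exists>p\<in>P. (\<Sum>p\<in>P. h p * w p) \<le> h p"
proof -
  have "P \<noteq> {}" using assms(3) by auto
  then obtain p where p: "p \<in> P" "\<And>q. q \<in> P \<Longrightarrow> h q \<le> h p"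
    using assms(1) obtains_MAX[of P h] by (metis Max_ge finite_imageI imageI)
  have "(\<Sum>q\<in>P. h q * w q) \<le> (\<Sum>q\<in>P. h p * w q)"
    using p(2) assms(2) by (intro sum_mono mult_right_mono) auto
  also have "\<dots> = h p" using assms(3) by (simp add: sum_distrib_left[symmetric])
  finally show ?thesis using p(1) by blast
qed

lemma sum_over_square_split:
  fixes f :: "'a \<Rightarrow> 'a \<Rightarrow> real"
  assumes "finite V" "U \<subseteq> V" "\<And>u v. f u v = f v u"
  shows "(\<Sum>u\<in>V. \<Sum>v\<in>V. f u v) = (\<Sum>u\<in>U. \<Sum>v\<in>U. f u v) +
    (\<Sum>u\<in>V - U. \<Sum>v\<in>V - U. f u v) + 2 * outflow f V U"
proof -
  have 1: "(\<Sum>v\<in>V. g v) = (\<Sum>v\<in>V - U. g v) + (\<Sum>v\<in>U. g v)" for g :: "'a \<Rightarrow> real"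
    using assms by (intro sum.subset_diff) auto
  have "(\<Sum>u\<in>V - U. \<Sum>v\<in>U. f u v) = outflow f V U"
    using outflow_complement[of f U V] assms(2,3) by (simp add: outflow_def double_diff)
  moreover have "(\<Sum>u\<in>U. \<Sum>v\<in>V - U. f u v) = outflow f V U"
    by (simp add: outflow_def)
  ultimately show ?thesis by (simp add: 1 sum.distrib)
qed

text \<open>
  By \<open>inner_cost_le_exit_cost\<close> on both sides, the fractional cost is at most the average of
  \<open>F u + G w + 2 * c u w\<close> over the edges from \<open>U\<close> to its complement, weighted by \<open>x\<close>. Tightness of
  \<open>U\<close> says that these weights add up to one. So some edge from \<open>u\<close> to \<open>w\<close> reaches the average, and
  it joins the best pairings of \<open>U - {u}\<close> and of \<open>(V - U) - {w}\<close>. Comparing costs in this way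
  avoids writing the fractional pairing as a convex combination.
\<close>

lemma pairing_of_tight_cut:
  fixes c :: "'a \<Rightarrow> 'a \<Rightarrow> real"
  assumes fin: "finite V" and x: "fractional_pairing V x"
    and c: "\<And>u v. c u v = c v u"
    and U: "U \<subseteq> V" "odd (card U)" "outflow x V U = 1" "2 \<le> card U" "2 \<le> card (V - U)"
    and IH: "\<And>V' :: 'a set. finite V' \<Longrightarrow> card V' < card V \<Longrightarrow> pairings_dominate V'"
  shows "\<exists>m. pairing V m \<and> (\<Sum>u\<in>V. \<Sum>v\<in>V. c u v * x u v) \<le> (\<Sum>v\<in>V. c v (m v))"
proof -
  note D = fractional_pairingD[OF x]
  define W where "W = V - U"
  have W: "W \<subseteq> V" "V - W = U" "U \<inter> W = {}" "V - U = W" using U(1) by (auto simp: W_def)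
  have finU: "finite U" and finW: "finite W" using U(1) W(1) fin by (auto intro: finite_subset)
  have card: "card V = card U + card W"
    using card_Un_disjoint[OF finU finW W(3)] U(1) W_def by (simp add: Un_absorb1)
  have cW: "2 \<le> card W" using U(5) by (simp add: W_def)
  have oddW: "odd (card W)" using fractional_pairing_even[OF x] U(2) card by simp
  have tightW: "outflow x V W = 1"
    using outflow_complement[of x U V] D(1) U(1,3) by (simp add: W_def)
  obtain s where s: "s \<in> V - U" using cW unfolding W_def by (cases "V - U = {}") auto
  obtain t where t: "t \<in> V - W" using U(4) W(2) by (cases "U = {}") auto
  have "card (insert s U) < card V" using s finU card cW by simp
  then have "pairings_dominate (insert s U)" using finU by (intro IH) auto
  from inner_cost_le_exit_cost[of V x U s c, OF fin x U(1-3) s c this]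
  obtain F where F: "\<And>u. u \<in> U \<Longrightarrow> \<exists>m. pairing (U - {u}) m \<and> (\<Sum>v\<in>U - {u}. c v (m v)) = F u"
    and leF: "(\<Sum>u\<in>U. \<Sum>v\<in>U. c u v * x u v) \<le> (\<Sum>u\<in>U. \<Sum>w\<in>W. F u * x u w)"
    unfolding W(4) by blast
  have "card (insert t W) < card V" using t finW card U(4) by simp
  then have "pairings_dominate (insert t W)" using finW by (intro IH) auto
  from inner_cost_le_exit_cost[of V x W t c, OF fin x W(1) oddW tightW t c this]
  obtain G where G: "\<And>u. u \<in> W \<Longrightarrow> \<exists>m. pairing (W - {u}) m \<and> (\<Sum>v\<in>W - {u}. c v (m v)) = G u"
    and leG: "(\<Sum>u\<in>W. \<Sum>v\<in>W. c u v * x u v) \<le> (\<Sum>w\<in>W. \<Sum>u\<in>U. G w * x w u)"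
    unfolding W(2) by blast
  define h where "h = (\<lambda>(u, w). F u + G w + 2 * c u w)"
  have "(\<Sum>w\<in>W. \<Sum>u\<in>U. G w * x w u) = (\<Sum>u\<in>U. \<Sum>w\<in>W. G w * x u w)"
    using D(1) by (subst sum.swap) simp
  moreover have "(\<Sum>u\<in>V. \<Sum>v\<in>V. c u v * x u v) =
      (\<Sum>u\<in>U. \<Sum>v\<in>U. c u v * x u v) + (\<Sum>u\<in>W. \<Sum>v\<in>W. c u v * x u v) +
      2 * (\<Sum>u\<in>U. \<Sum>w\<in>W. c u w * x u w)"
    using sum_over_square_split[OF fin U(1), of "\<lambda>u v. c u v * x u v"] c D(1)
    by (simp add: outflow_def W(4))
  moreover have "(\<Sum>p\<in>U \<times> W. h p * (case p of (u, w) \<Rightarrow> x u w)) =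
      (\<Sum>u\<in>U. \<Sum>w\<in>W. (F u + G w + 2 * c u w) * x u w)"
    unfolding sum.cartesian_product by (intro sum.cong) (auto simp: h_def)
  ultimately have total: "(\<Sum>u\<in>V. \<Sum>v\<in>V. c u v * x u v) \<le>
      (\<Sum>p\<in>U \<times> W. h p * (case p of (u, w) \<Rightarrow> x u w))"
    using leF leG
    by (simp add: algebra_simps sum.distrib sum_distrib_left)
  have "\<exists>p\<in>U \<times> W. (\<Sum>p\<in>U \<times> W. h p * (case p of (u, w) \<Rightarrow> x u w)) \<le> h p"
  proof (rule weighted_average_le_some_value)
    show "finite (U \<times> W)" using finU finW by simp
    show "0 \<le> (case p of (u, w) \<Rightarrow> x u w)" if "p \<in> U \<times> W" for p
      using that U(1) W(1) D(2) by auto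
    show "(\<Sum>p\<in>U \<times> W. case p of (u, w) \<Rightarrow> x u w) = 1"
      using U(3) by (simp add: outflow_def W(4) sum.cartesian_product)
  qed
  with total obtain u w where uw: "u \<in> U" "w \<in> W"
    and le: "(\<Sum>u\<in>V. \<Sum>v\<in>V. c u v * x u v) \<le> F u + G w + 2 * c u w"
    by (auto simp: h_def)
  obtain m where m: "pairing (U - {u}) m" "(\<Sum>v\<in>U - {u}. c v (m v)) = F u"
    using F[OF uw(1)] by blast
  obtain n where n: "pairing (W - {w}) n" "(\<Sum>v\<in>W - {w}. c v (n v)) = G w"
    using G[OF uw(2)] by blast
  have neq: "u \<noteq> w" using uw W(3) by blast
  define k where "k v = (if v \<in> U - {u} then m v else if v \<in> W - {w} then n v
    else if v = u then w else u)" for v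
  have "pairing ((U - {u}) \<union> ((W - {w}) \<union> {u, w})) k"
    unfolding k_def
    by (intro pairing_Un m(1) n(1) pairing_transposition neq) (use W(3) uw in auto)
  moreover have V: "(U - {u}) \<union> ((W - {w}) \<union> {u, w}) = V"
    using uw U(1) W(1) unfolding W_def by blast
  moreover have "(\<Sum>v\<in>V. c v (k v)) = F u + G w + 2 * c u w"
  proof -
    have "(\<Sum>v\<in>V. c v (k v)) = (\<Sum>v\<in>U - {u}. c v (k v)) +
        ((\<Sum>v\<in>W - {w}. c v (k v)) + (\<Sum>v\<in>{u, w}. c v (k v)))"
      unfolding V[symmetric] using finU finW W(3) uw
      by (subst sum.union_disjoint; (subst sum.union_disjoint)?) auto
    moreover have "(\<Sum>v\<in>U - {u}. c v (k v)) = F u"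
      unfolding m(2)[symmetric] by (intro sum.cong) (auto simp: k_def)
    moreover have "(\<Sum>v\<in>W - {w}. c v (k v)) = G w"
      unfolding n(2)[symmetric] using W(3) by (intro sum.cong) (auto simp: k_def)
    moreover have "(\<Sum>v\<in>{u, w}. c v (k v)) = 2 * c u w"
      using neq uw W(3) c[of w u] by (auto simp: k_def)
    ultimately show ?thesis by simp
  qed
  ultimately show ?thesis using le by auto
qed

section \<open>Moving to a tight cut or a smaller support\<close>

text \<open>
  If all weight at \<open>v\<close> goes to \<open>a\<close> and \<open>b\<close>, then \<open>v, a, b\<close> have total degree 3, of which the
  edges at \<open>v\<close> inside the triple use up 2. So at most 1 leaves the triple, and at least 1 must
  leave it because the triple is odd.
\<close>

lemma tight_triple_at_low_degree:
  assumes fin: "finite V" "4 \<le> card V" and x: "fractional_pairing V x"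
    and v: "v \<in> V" "card {w \<in> V. x v w \<noteq> 0} < 3"
  shows "\<exists>U\<subseteq>V. card U = 3 \<and> outflow x V U = 1"
proof -
  note D = fractional_pairingD[OF x]
  define N where "N = {w \<in> V. x v w \<noteq> 0}"
  have N: "N \<subseteq> V - {v}" using D(3)[OF v(1)] by (auto simp: N_def)
  have "card (V - {v}) \<ge> 3" using fin v(1) by simp
  then obtain P where P: "N \<subseteq> P" "P \<subseteq> V - {v}" "card P = 2"
    using exists_subset_between[of N 2 "V - {v}"] N v(2) fin(1) by (auto simp: N_def)
  then obtain a b where ab: "P = {a, b}" "a \<noteq> b" by (auto simp: card_2_iff)
  have in_V: "a \<in> V" "b \<in> V" "a \<noteq> v" "b \<noteq> v" using P ab by auto
  define U where "U = {v, a, b}"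
  have U: "U \<subseteq> V" "card U = 3" using in_V ab v(1) by (auto simp: U_def)
  have "(\<Sum>w\<in>P. x v w) = (\<Sum>w\<in>V. x v w)"
    using fin(1) P by (intro sum.mono_neutral_left) (auto simp: N_def)
  then have row: "x v a + x v b = 1" using ab D(4)[OF v(1)] by simp
  have "outflow x V U = (\<Sum>u\<in>U. 1 - (\<Sum>w\<in>U. x u w))"
    unfolding outflow_def using U(1) fin(1) D(4)
    by (intro sum.cong refl) (subst sum_diff, auto)
  also have "\<dots> = 1 - 2 * x a b"
    using in_V ab v(1) row D(1)[of a v] D(1)[of b v] D(1)[of b a] D(3) by (simp add: U_def)
  finally have "outflow x V U \<le> 1" using D(2)[OF in_V(1,2)] by simp
  moreover have "1 \<le> outflow x V U" using D(5)[OF U(1)] U(2) by simp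
  ultimately have "outflow x V U = 1" by (rule antisym)
  then show ?thesis using U by blast
qed

text \<open>
  Gaussian elimination of one equation and one unknown.
\<close>

lemma underdetermined_system_solvable:
  fixes A :: "'v \<Rightarrow> 'e \<Rightarrow> real"
  assumes "finite V" "finite E" "card V < card E"
  shows "\<exists>z. (\<exists>e\<in>E. z e \<noteq> 0) \<and> (\<forall>v\<in>V. (\<Sum>e\<in>E. A v e * z e) = 0)"
  using assms
proof (induction V arbitrary: A E rule: finite_induct)
  case empty
  then have "E \<noteq> {}" by auto
  then show ?case by (intro exI[of _ "\<lambda>_. 1"]) auto
next
  case (insert v V)
  show ?case
  proof (cases "\<forall>e\<in>E. A v e = 0")
    case True
    then show ?thesis using insert.IH[of E A] insert.prems insert.hyps by auto
  next
    case False
    then obtain e0 where e0: "e0 \<in> E" "A v e0 \<noteq> 0" by blast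
    \<comment> \<open>Equation \<open>v\<close> is solved for the unknown \<open>e0\<close> and substituted into the others.\<close>
    define B where "B w e = A w e - A w e0 * A v e / A v e0" for w e
    have "card V < card (E - {e0})" using insert.prems insert.hyps e0 by simp
    with insert.IH[of "E - {e0}" B] insert.prems
    obtain z where z: "\<exists>e\<in>E - {e0}. z e \<noteq> 0" "\<And>w. w \<in> V \<Longrightarrow> (\<Sum>e\<in>E - {e0}. B w e * z e) = 0"
      by auto
    define z' where "z' = z(e0 := - (\<Sum>e\<in>E - {e0}. A v e * z e) / A v e0)"
    have sum: "(\<Sum>e\<in>E. A w e * z' e) = A w e0 * z' e0 + (\<Sum>e\<in>E - {e0}. A w e * z e)" for w
    proof -
      have "(\<Sum>e\<in>E - {e0}. A w e * z' e) = (\<Sum>e\<in>E - {e0}. A w e * z e)"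
        by (intro sum.cong) (auto simp: z'_def)
      then show ?thesis using e0(1) insert.prems(1) by (simp add: sum.remove)
    qed
    have "(\<Sum>e\<in>E. A v e * z' e) = 0" unfolding sum using e0(2) by (simp add: z'_def)
    moreover have "(\<Sum>e\<in>E. A w e * z' e) = 0" if "w \<in> V" for w
    proof -
      have "(\<Sum>e\<in>E - {e0}. B w e * z e) = (\<Sum>e\<in>E - {e0}. A w e * z e) -
          A w e0 / A v e0 * (\<Sum>e\<in>E - {e0}. A v e * z e)"
        by (simp add: B_def left_diff_distrib sum_subtractf sum_distrib_left mult.assoc)
      then show ?thesis unfolding sum using z(2)[OF that] by (simp add: z'_def)
    qed
    moreover have "\<exists>e\<in>E. z' e \<noteq> 0" using z(1) by (auto simp: z'_def)
    ultimately show ?thesis by blast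
  qed
qed

text \<open>
  With at least three support edges at every vertex there are at least \<open>3 * card V / 2\<close> support edges,
  hence more unknowns than degree equations.
\<close>

lemma degree_zero_direction:
  assumes fin: "finite V" "V \<noteq> {}" and x: "fractional_pairing V x"
    and deg: "\<And>u. u \<in> V \<Longrightarrow> 3 \<le> card {v \<in> V. x u v \<noteq> 0}"
  shows "\<exists>y :: 'a \<Rightarrow> 'a \<Rightarrow> real. (\<forall>u v. y u v = y v u) \<and> (\<exists>u\<in>V. \<exists>v\<in>V. y u v \<noteq> 0) \<and>
    (\<forall>u\<in>V. (\<Sum>v\<in>V. y u v) = 0) \<and> (\<forall>u\<in>V. \<forall>v\<in>V. x u v = 0 \<longrightarrow> y u v = 0)"
proof -
  note D = fractional_pairingD[OF x]
  define E where "E = {{u, v} | u v. u \<in> V \<and> v \<in> V \<and> x u v \<noteq> 0}"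
  have edge: "{u, v} \<in> E \<longleftrightarrow> x u v \<noteq> 0" if "u \<in> V" "v \<in> V" for u v
    using that D(1) by (auto simp: E_def doubleton_eq_iff)
  have "card {u, v} = 2" if "u \<in> V" "x u v \<noteq> 0" for u v
    using that D(3) by (cases "u = v") auto
  then have G: "simple_graph V E"
    using fin unfolding simple_graph_def E_def by auto
  note GD = simple_graphD[OF G]
  have "3 \<le> card {e. e \<in> E \<and> u \<in> e}" if u: "u \<in> V" for u
  proof -
    have "card {v \<in> V. x u v \<noteq> 0} = (\<Sum>v\<in>V. if {u, v} \<in> E then 1 else 0)"
      using u edge fin by (simp add: sum.inter_filter[symmetric])
    also have "\<dots> = card {e. e \<in> E \<and> u \<in> e}"
      using sum_over_neighbours[OF G u, of "\<lambda>_. 1 :: nat"] by simp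
    finally show ?thesis using deg[OF u] by simp
  qed
  then have "(\<Sum>u\<in>V. 3) \<le> (\<Sum>u\<in>V. card {e. e \<in> E \<and> u \<in> e})" by (intro sum_mono)
  also have "\<dots> = (\<Sum>e\<in>E. card (e \<inter> V))"
    using weighted_handshake[of V E "\<lambda>_. 1 :: nat"] GD by simp
  also have "\<dots> = 2 * card E" using GD(3,4) by (simp add: Int_absorb2)
  finally have "3 * card V \<le> 2 * card E" by simp
  moreover have "0 < card V" using fin by (simp add: card_gt_0_iff)
  ultimately have "card V < card E" by linarith
  from underdetermined_system_solvable[OF fin(1) GD(2) this, of "\<lambda>v e. of_bool (v \<in> e)"]
  obtain z :: "'a set \<Rightarrow> real"
    where z: "\<exists>e\<in>E. z e \<noteq> 0" "\<And>v. v \<in> V \<Longrightarrow> (\<Sum>e\<in>E. of_bool (v \<in> e) * z e) = 0"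
    by blast
  define y where "y u v = (if {u, v} \<in> E then z {u, v} else 0)" for u v
  have "y u v = y v u" for u v by (simp add: y_def insert_commute)
  moreover have "\<exists>u\<in>V. \<exists>v\<in>V. y u v \<noteq> 0"
  proof -
    obtain e where e: "e \<in> E" "z e \<noteq> 0" using z(1) by blast
    then obtain u v where "u \<in> V" "v \<in> V" "e = {u, v}" unfolding E_def by blast
    then show ?thesis using e by (auto simp: y_def)
  qed
  moreover have "(\<Sum>v\<in>V. y u v) = 0" if u: "u \<in> V" for u
  proof -
    have "(\<Sum>v\<in>V. y u v) = (\<Sum>e | e \<in> E \<and> u \<in> e. z e)"
      unfolding y_def by (rule sum_over_neighbours[OF G u])
    also have "\<dots> = (\<Sum>e\<in>E. if u \<in> e then z e else 0)" using GD(2) by (rule sum.inter_filter)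
    also have "\<dots> = (\<Sum>e\<in>E. of_bool (u \<in> e) * z e)" by (intro sum.cong) auto
    finally show ?thesis using z(2)[OF u] by simp
  qed
  moreover have "y u v = 0" if "u \<in> V" "v \<in> V" "x u v = 0" for u v
    using edge[OF that(1,2)] that(3) by (simp add: y_def)
  ultimately show ?thesis by blast
qed

text \<open>
  The ratio test of linear programming; a pair \<open>(a, b)\<close> is the constraint \<open>0 \<le> a + t * b\<close>.
\<close>

lemma first_zero_along_ray:
  fixes S :: "(real \<times> real) set"
  assumes "finite S" "\<And>a b. (a, b) \<in> S \<Longrightarrow> 0 \<le> a" "(a0, b0) \<in> S" "b0 < 0"
  shows "\<exists>t\<ge>0. (\<forall>(a, b)\<in>S. 0 \<le> a + t * b) \<and> (\<exists>(a, b)\<in>S. b < 0 \<and> a + t * b = 0)"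
proof -
  define R where "R = {p \<in> S. snd p < 0}"
  define t where "t = Min ((\<lambda>(a, b). a / - b) ` R)"
  have R: "finite R" "R \<noteq> {}" using assms by (auto simp: R_def)
  then have "t \<in> (\<lambda>(a, b). a / - b) ` R" unfolding t_def by (intro Min_in) auto
  then obtain a b where ab: "(a, b) \<in> S" "b < 0" "t = a / - b" by (auto simp: R_def)
  have "t \<ge> 0" using ab assms(2)[OF ab(1)] by (simp add: divide_nonneg_neg)
  moreover have "0 \<le> a' + t * b'" if "(a', b') \<in> S" for a' b'
  proof (cases "b' < 0")
    case True
    then have "t \<le> a' / - b'"
      unfolding t_def using R(1) that by (intro Min_le) (force simp: R_def)+
    then have "t * - b' \<le> a'" using True by (subst (asm) pos_le_divide_eq) auto
    then show ?thesis by simp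
  next
    case False
    then show ?thesis using assms(2)[OF that] \<open>t \<ge> 0\<close> by simp
  qed
  moreover have "a + t * b = 0" using ab by simp
  ultimately show ?thesis using ab by blast
qed

text \<open>
  Moving along \<open>y\<close> until the first constraint becomes tight. Sets with at most one vertex and
  their complements cannot be the reason for stopping, because \<open>y\<close> has outflow zero there.
\<close>

lemma fractional_pairing_move_to_boundary:
  assumes fin: "finite V" and x: "fractional_pairing V x"
    and y: "\<And>u v. y u v = y v u" "\<And>u. u \<in> V \<Longrightarrow> (\<Sum>v\<in>V. y u v) = 0"
      "\<And>u v. u \<in> V \<Longrightarrow> v \<in> V \<Longrightarrow> x u v = 0 \<Longrightarrow> y u v = 0"
    and nz: "\<exists>u\<in>V. \<exists>v\<in>V. y u v \<noteq> 0"
  shows "\<exists>t\<ge>0. fractional_pairing V (\<lambda>u v. x u v + t * y u v) \<and>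
    ((\<exists>u\<in>V. \<exists>v\<in>V. x u v \<noteq> 0 \<and> x u v + t * y u v = 0) \<or>
     (\<exists>U\<subseteq>V. odd (card U) \<and> 2 \<le> card U \<and> 2 \<le> card (V - U) \<and>
        outflow (\<lambda>u v. x u v + t * y u v) V U = 1))"
proof -
  note D = fractional_pairingD[OF x]
  define S where "S = (\<lambda>(u, v). (x u v, y u v)) ` (V \<times> V) \<union>
    (\<lambda>U. (outflow x V U - 1, outflow y V U)) ` {U. U \<subseteq> V \<and> odd (card U)}"
  obtain u v where uv: "u \<in> V" "v \<in> V" "y u v \<noteq> 0" using nz by blast
  have neg: "\<exists>w\<in>V. y u w < 0"
  proof (rule ccontr)
    assume "\<not> (\<exists>w\<in>V. y u w < 0)"
    then have "\<forall>w\<in>V. y u w = 0"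
      using sum_nonneg_eq_0_iff[of V "y u"] y(2)[OF uv(1)] fin by (auto simp: not_less)
    then show False using uv by blast
  qed
  then obtain w where w: "w \<in> V" "y u w < 0" by blast
  have outflow: "outflow (\<lambda>u v. x u v + t * y u v) V U = outflow x V U + t * outflow y V U" for t U
    by (simp add: outflow_def sum.distrib sum_distrib_left)
  have "\<exists>t\<ge>0. (\<forall>(a, b)\<in>S. 0 \<le> a + t * b) \<and> (\<exists>(a, b)\<in>S. b < 0 \<and> a + t * b = 0)"
  proof (rule first_zero_along_ray)
    show "finite S" using fin by (auto simp: S_def)
    show "0 \<le> a" if "(a, b) \<in> S" for a b
      using that D(2,5) by (auto simp: S_def)
    show "(x u w, y u w) \<in> S" using uv w by (auto simp: S_def)
    show "y u w < 0" by (rule w(2))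
  qed
  then obtain t a b where t: "t \<ge> 0" "\<And>a b. (a, b) \<in> S \<Longrightarrow> 0 \<le> a + t * b"
    and ab: "(a, b) \<in> S" "b < 0" "a + t * b = 0" by blast
  have "fractional_pairing V (\<lambda>u v. x u v + t * y u v)"
    unfolding fractional_pairing_def
  proof (intro conjI allI ballI impI)
    fix u v show "x u v + t * y u v = x v u + t * y v u" using D(1)[of u v] y(1)[of u v] by simp
  next
    fix u v assume "u \<in> V" "v \<in> V"
    then show "0 \<le> x u v + t * y u v" by (intro t(2)) (auto simp: S_def)
  next
    fix u assume u: "u \<in> V"
    show "x u u + t * y u u = 0" using D(3)[OF u] y(3)[OF u u] by simp
    show "(\<Sum>v\<in>V. x u v + t * y u v) = 1"
      using D(4)[OF u] y(2)[OF u] by (simp add: sum.distrib sum_distrib_left[symmetric])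
  next
    fix U assume "U \<subseteq> V" "odd (card U)"
    then have "0 \<le> outflow x V U - 1 + t * outflow y V U"
      by (intro t(2)) (auto simp: S_def)
    then show "1 \<le> outflow (\<lambda>u v. x u v + t * y u v) V U" by (simp add: outflow)
  qed
  moreover have "(\<exists>u\<in>V. \<exists>v\<in>V. x u v \<noteq> 0 \<and> x u v + t * y u v = 0) \<or>
     (\<exists>U\<subseteq>V. odd (card U) \<and> 2 \<le> card U \<and> 2 \<le> card (V - U) \<and>
        outflow (\<lambda>u v. x u v + t * y u v) V U = 1)"
  proof (cases "\<exists>u\<in>V. \<exists>v\<in>V. (a, b) = (x u v, y u v)")
    case True
    then show ?thesis using ab y(3) by fastforce
  next
    case False
    then obtain U where U: "U \<subseteq> V" "odd (card U)" "a = outflow x V U - 1" "b = outflow y V U"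
      using ab(1) by (auto simp: S_def)
    have single: "outflow y V {u} = 0" if "u \<in> V" for u
      using outflow_singleton[OF fin that] y(2,3)[OF that] D(3)[OF that] that by simp
    have "card U \<noteq> 1" using single U ab(2) by (auto simp: card_1_singleton_iff)
    moreover have "card (V - U) \<noteq> 1"
    proof
      assume "card (V - U) = 1"
      then obtain w where w: "V - U = {w}" by (auto simp: card_1_singleton_iff)
      then have "outflow y V (V - U) = 0" using single[of w] by auto
      then show False using outflow_complement[of y U V] y(1) U(1,4) ab(2) by simp
    qed
    moreover have "card U \<noteq> 0" using U(2) by (cases "card U") auto
    moreover have "card (V - U) \<noteq> 0"
    proof
      assume "card (V - U) = 0"
      then have "V - U = {}" using fin by simp
      then have "outflow y V U = 0" unfolding outflow_def by (simp only: sum.empty sum.neutral_const)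
      then show False using U(4) ab(2) by simp
    qed
    ultimately have "2 \<le> card U" "2 \<le> card (V - U)" by linarith+
    then show ?thesis using U ab(3) outflow[of t U] by force
  qed
  ultimately show ?thesis using t(1) by blast
qed

section \<open>Pairings dominate fractional pairings\<close>

text \<open>
  On four vertices the degree constraints force opposite edges to carry equal weight, so a
  fractional pairing is a weighted average of the three pairings.
\<close>

lemma pairings_dominate_small:
  assumes fin: "finite V" and card: "card V \<le> 4"
  shows "pairings_dominate V"
  unfolding pairings_dominate_def
proof (intro allI impI)
  fix x and c :: "'a \<Rightarrow> 'a \<Rightarrow> real"
  assume x: "fractional_pairing V x" and c: "\<forall>u v. c u v = c v u"
  note D = fractional_pairingD[OF x]
  have "card V = 0 \<or> card V = 2 \<or> card V = 4"
    using card fractional_pairing_even[OF x] by presburger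
  then show "\<exists>m. pairing V m \<and> (\<Sum>u\<in>V. \<Sum>v\<in>V. c u v * x u v) \<le> (\<Sum>v\<in>V. c v (m v))"
  proof (elim disjE)
    assume "card V = 0"
    then show ?thesis using fin by (auto simp: pairing_def)
  next
    assume "card V = 2"
    then obtain a b where ab: "V = {a, b}" "a \<noteq> b" by (auto simp: card_2_iff)
    have "x a b = 1" "x b a = 1" "x a a = 0" "x b b = 0"
      using D(3,4)[of a] D(3,4)[of b] ab by auto
    then show ?thesis using pairing_transposition[OF ab(2)] ab
      by (intro exI[of _ "\<lambda>v. if v = a then b else a"]) auto
  next
    assume "card V = 4"
    then obtain a B where B: "V = insert a B" "a \<notin> B" "card B = 3"
      using card_Suc_eq[of V 3] by auto
    then obtain b p d where "B = {b, p, d}" "b \<noteq> p" "p \<noteq> d" "b \<noteq> d" by (auto simp: card_3_iff)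
    then have V: "V = {a, b, p, d}" and neq: "distinct [a, b, p, d]" using B by auto
    have in_V: "a \<in> V" "b \<in> V" "p \<in> V" "d \<in> V" using V by auto
    have pair: "\<exists>m. pairing V m \<and> (\<Sum>v\<in>V. c v (m v)) = 2 * (c q r + c s t)"
      if "V = {q, r} \<union> {s, t}" "distinct [q, r, s, t]" for q r s t
    proof -
      let ?m = "\<lambda>v. if v \<in> {q, r} then if v = q then r else q else if v = s then t else s"
      have "pairing V ?m" unfolding that(1)
        using that(2) by (intro pairing_Un pairing_transposition) auto
      moreover have "(\<Sum>v\<in>V. c v (?m v)) = 2 * (c q r + c s t)"
        using that c[rule_format, of r q] c[rule_format, of t s] by auto
      ultimately show ?thesis by blast
    qed
    have diag: "x a a = 0" "x b b = 0" "x p p = 0" "x d d = 0" using D(3) in_V by auto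
    have sym: "x b a = x a b" "x p a = x a p" "x d a = x a d" "x p b = x b p" "x d b = x b d"
      "x d p = x p d" using D(1) by auto
    have rows: "x a b + x a p + x a d = 1" "x a b + x b p + x b d = 1"
      "x a p + x b p + x p d = 1" "x a d + x b d + x p d = 1"
      using D(4)[OF in_V(1)] D(4)[OF in_V(2)] D(4)[OF in_V(3)] D(4)[OF in_V(4)] neq diag sym
      by (simp_all add: V)
    have opposite: "x p d = x a b" "x b d = x a p" "x b p = x a d"
      using rows by linarith+
    define w where "w i = (if i = 0 then x a b else if i = 1 then x a p else x a d)" for i :: nat
    define h where "h i = 2 * (if i = 0 then c a b + c p d else if i = 1 then c a p + c b d
      else c a d + c b p)" for i :: nat
    have "\<exists>i\<in>{0, 1, 2}. (\<Sum>i\<in>{0, 1, 2}. h i * w i) \<le> h i"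
      using D(2)[OF in_V(1)] in_V rows(1)
      by (intro weighted_average_le_some_value) (auto simp: w_def)
    moreover have "(\<Sum>u\<in>V. \<Sum>v\<in>V. c u v * x u v) = (\<Sum>i\<in>{0, 1, 2}. h i * w i)"
      using neq diag sym opposite c[rule_format, of b a] c[rule_format, of p a]
        c[rule_format, of d a] c[rule_format, of p b] c[rule_format, of d b] c[rule_format, of d p]
      by (simp add: V h_def w_def algebra_simps)
    moreover have "\<exists>m. pairing V m \<and> (\<Sum>v\<in>V. c v (m v)) = h i" if "i \<in> {0, 1, 2}" for i
      using that pair[of a b p d] pair[of a p b d] pair[of a d b p] neq
      by (auto simp: h_def V insert_commute)
    ultimately show ?thesis by metis
  qed
qed

text \<open>
  Induction on the number of vertices. For a fixed vertex set, an inner induction on the size of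
  the support replaces \<open>x\<close> by a point on the boundary that costs at least as much, until a tight
  odd cut with at least two vertices on each side appears. The bound of four vertices is what
  makes the complement of a tight triple have at least two vertices.
\<close>

lemma pairings_dominate_fractional_pairings:
  assumes "finite V"
  shows "pairings_dominate V"
  using assms
proof (induction "card V" arbitrary: V rule: less_induct)
  case less
  note fin = less.prems
  have IH: "pairings_dominate V'" if "finite V'" "card V' < card V" for V' :: "'a set"
    using less.hyps that by blast
  show ?case
  proof (cases "card V \<le> 4")
    case True
    then show ?thesis using pairings_dominate_small fin by blast
  next
    case False
    then have big: "4 < card V" by simp
    have dom: "\<exists>m. pairing V m \<and> (\<Sum>u\<in>V. \<Sum>v\<in>V. c u v * x u v) \<le> (\<Sum>v\<in>V. c v (m v))"
      if "fractional_pairing V x" and c: "\<And>u v. c u v = c v u" for x and c :: "'a \<Rightarrow> 'a \<Rightarrow> real"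
      using that(1)
    proof (induction "card {(u, v) \<in> V \<times> V. x u v \<noteq> 0}" arbitrary: x rule: less_induct)
      case (less x)
      note x = less.prems
      show ?case
      proof (cases "\<exists>v\<in>V. card {w \<in> V. x v w \<noteq> 0} < 3")
        case True
        then obtain U where U: "U \<subseteq> V" "card U = 3" "outflow x V U = 1"
          using tight_triple_at_low_degree[OF fin _ x] big by auto
        have "card (V - U) = card V - 3"
          using U fin by (metis card_Diff_subset finite_subset)
        then have "2 \<le> card (V - U)" using big by simp
        with U IH show ?thesis by (intro pairing_of_tight_cut[of V x c U, OF fin x c]) simp_all
      next
        case False
        then have deg: "\<And>u. u \<in> V \<Longrightarrow> 3 \<le> card {v \<in> V. x u v \<noteq> 0}" by (auto simp: not_less)
        have "V \<noteq> {}" using big by auto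
        from degree_zero_direction[OF fin this x deg]
        obtain y0 where y0: "\<And>u v. y0 u v = y0 v u" "\<exists>u\<in>V. \<exists>v\<in>V. y0 u v \<noteq> 0"
          "\<And>u. u \<in> V \<Longrightarrow> (\<Sum>v\<in>V. y0 u v) = (0 :: real)"
          "\<And>u v. u \<in> V \<Longrightarrow> v \<in> V \<Longrightarrow> x u v = 0 \<Longrightarrow> y0 u v = 0" by blast
        \<comment> \<open>The sign is chosen so that moving along \<open>y\<close> does not decrease the cost.\<close>
        define sg :: real where
          "sg = (if 0 \<le> (\<Sum>u\<in>V. \<Sum>v\<in>V. c u v * y0 u v) then 1 else - 1)"
        define y where "y u v = sg * y0 u v" for u v
        have "sg \<noteq> 0" by (simp add: sg_def)
        then have y: "\<And>u v. y u v = y v u" "\<And>u. u \<in> V \<Longrightarrow> (\<Sum>v\<in>V. y u v) = 0"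
          "\<And>u v. u \<in> V \<Longrightarrow> v \<in> V \<Longrightarrow> x u v = 0 \<Longrightarrow> y u v = 0" "\<exists>u\<in>V. \<exists>v\<in>V. y u v \<noteq> 0"
          using y0 by (simp_all add: y_def sum_distrib_left[symmetric])
        have "(\<Sum>u\<in>V. \<Sum>v\<in>V. c u v * y u v) = sg * (\<Sum>u\<in>V. \<Sum>v\<in>V. c u v * y0 u v)"
          by (simp add: y_def sum_distrib_left mult.left_commute)
        then have improve: "0 \<le> (\<Sum>u\<in>V. \<Sum>v\<in>V. c u v * y u v)"
          by (simp add: sg_def)
        obtain t where t: "t \<ge> 0" "fractional_pairing V (\<lambda>u v. x u v + t * y u v)"
          and boundary: "(\<exists>u\<in>V. \<exists>v\<in>V. x u v \<noteq> 0 \<and> x u v + t * y u v = 0) \<or>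
            (\<exists>U\<subseteq>V. odd (card U) \<and> 2 \<le> card U \<and> 2 \<le> card (V - U) \<and>
              outflow (\<lambda>u v. x u v + t * y u v) V U = 1)"
          using fractional_pairing_move_to_boundary[OF fin x y] by blast
        define x' where "x' u v = x u v + t * y u v" for u v
        have "(\<Sum>u\<in>V. \<Sum>v\<in>V. c u v * x' u v) = (\<Sum>u\<in>V. \<Sum>v\<in>V. c u v * x u v) +
            t * (\<Sum>u\<in>V. \<Sum>v\<in>V. c u v * y u v)"
          by (simp add: x'_def algebra_simps sum.distrib sum_distrib_left)
        then have le: "(\<Sum>u\<in>V. \<Sum>v\<in>V. c u v * x u v) \<le> (\<Sum>u\<in>V. \<Sum>v\<in>V. c u v * x' u v)"
          using t(1) improve by simp
        have x': "fractional_pairing V x'" using t(2) by (simp add: x'_def[abs_def])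
        from boundary have "\<exists>m. pairing V m \<and>
          (\<Sum>u\<in>V. \<Sum>v\<in>V. c u v * x' u v) \<le> (\<Sum>v\<in>V. c v (m v))"
        proof
          assume "\<exists>u\<in>V. \<exists>v\<in>V. x u v \<noteq> 0 \<and> x u v + t * y u v = 0"
          then obtain u v where uv: "u \<in> V" "v \<in> V" "x u v \<noteq> 0" "x' u v = 0"
            by (auto simp: x'_def)
          have "{(u, v) \<in> V \<times> V. x' u v \<noteq> 0} \<subset> {(u, v) \<in> V \<times> V. x u v \<noteq> 0}"
            (is "?S' \<subset> ?S")
          proof (intro psubsetI)
            show "?S' \<subseteq> ?S" using y(3) by (auto simp: x'_def)
            show "?S' \<noteq> ?S" using uv by blast
          qed
          moreover have "finite {(u, v) \<in> V \<times> V. x u v \<noteq> 0}"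
            using fin by (auto intro: finite_subset[of _ "V \<times> V"])
          ultimately have "card {(u, v) \<in> V \<times> V. x' u v \<noteq> 0} < card {(u, v) \<in> V \<times> V. x u v \<noteq> 0}"
            by (rule psubset_card_mono[rotated])
          from less.hyps[OF this x'] show ?thesis .
        next
          assume "\<exists>U\<subseteq>V. odd (card U) \<and> 2 \<le> card U \<and> 2 \<le> card (V - U) \<and>
              outflow (\<lambda>u v. x u v + t * y u v) V U = 1"
          then obtain U where U: "U \<subseteq> V" "odd (card U)" "outflow x' V U = 1" "2 \<le> card U"
            "2 \<le> card (V - U)" by (auto simp: x'_def[abs_def])
          show ?thesis by (rule pairing_of_tight_cut[of V x' c U, OF fin x' c U IH])
        qed
        then show ?thesis using le by (blast intro: order_trans)
      qed
    qed
    show ?thesis unfolding pairings_dominate_def by (intro allI impI dom) auto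
  qed
qed

section \<open>Perfect matchings of a graph\<close>

text \<open>
  For edges with two ends, meeting \<open>U\<close> in exactly one vertex is the same as joining \<open>U\<close> to its
  complement.
\<close>

definition cut :: "'a set set \<Rightarrow> 'a set \<Rightarrow> 'a set set" where
  "cut F U = {e \<in> F. card (e \<inter> U) = 1}"

definition fractional_perfect_matching :: "'a set \<Rightarrow> 'a set set \<Rightarrow> ('a set \<Rightarrow> real) \<Rightarrow> bool" where
  "fractional_perfect_matching V E w \<longleftrightarrow>
     (\<forall>e\<in>E. 0 \<le> w e) \<and>
     (\<forall>v\<in>V. (\<Sum>e | e \<in> E \<and> v \<in> e. w e) = 1) \<and>
     (\<forall>U\<subseteq>V. odd (card U) \<longrightarrow> 1 \<le> (\<Sum>e\<in>cut E U. w e))"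

lemma card_inter_le_2:
  assumes "simple_graph V E" "e \<in> E"
  shows "card (e \<inter> U) \<le> 2"
  using simple_graphD(4)[OF assms] by (metis Int_lower1 card.infinite card_mono zero_neq_numeral)

lemma doubleton_in_cut_iff:
  assumes "simple_graph V E" "{u, v} \<in> E" "u \<in> U"
  shows "{u, v} \<in> cut E U \<longleftrightarrow> v \<notin> U"
proof -
  have "u \<noteq> v" using simple_graphD(4)[OF assms(1,2)] by auto
  then show ?thesis using assms(2,3) by (auto simp: cut_def Int_insert_left)
qed

lemma outflow_of_edge_weights:
  assumes G: "simple_graph V E" and U: "U \<subseteq> V"
  shows "outflow (\<lambda>u v. if {u, v} \<in> E then w {u, v} else 0) V U = (\<Sum>e\<in>cut E U. w e)"
proof -
  note GD = simple_graphD[OF G]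
  define w' where "w' e = (if e \<in> cut E U then w e else 0)" for e
  have "(\<Sum>v\<in>V - U. if {u, v} \<in> E then w {u, v} else 0) = (\<Sum>e | e \<in> E \<and> u \<in> e. w' e)"
    if u: "u \<in> U" for u
  proof -
    have "(\<Sum>v\<in>V - U. if {u, v} \<in> E then w {u, v} else 0) =
        (\<Sum>v\<in>V. if {u, v} \<in> E then w' {u, v} else 0)"
      using GD(1) doubleton_in_cut_iff[OF G _ u]
      by (intro sum.mono_neutral_cong_left) (auto simp: w'_def)
    then show ?thesis using sum_over_neighbours[OF G, of u w'] u U by auto
  qed
  then have "outflow (\<lambda>u v. if {u, v} \<in> E then w {u, v} else 0) V U =
      (\<Sum>e\<in>E. real (card (e \<inter> U)) * w' e)"
    using weighted_handshake[of U E w'] GD(1,2) U by (simp add: outflow_def finite_subset)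
  also have "\<dots> = (\<Sum>e\<in>cut E U. w e)"
    using GD(2) by (intro sum.mono_neutral_cong_right) (auto simp: w'_def cut_def)
  finally show ?thesis .
qed

text \<open>
  The sum of the degrees in \<open>U\<close> is odd; it counts every edge inside \<open>U\<close> twice and every edge of
  the cut once.
\<close>

lemma odd_cut_of_odd_set:
  assumes G: "simple_graph V E" and U: "U \<subseteq> V" "odd (card U)"
    and deg: "\<And>v. v \<in> V \<Longrightarrow> odd (degree E v)"
  shows "odd (card (cut E U))"
proof -
  note GD = simple_graphD[OF G]
  have finU: "finite U" using GD(1) U(1) by (rule finite_subset[rotated])
  have "(\<Sum>v\<in>U. degree E v) = (\<Sum>e\<in>E. card (e \<inter> U))"
    using weighted_handshake[of U E "\<lambda>_. 1 :: nat"] finU GD(2) by (simp add: degree_def)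
  moreover have "{v \<in> U. odd (degree E v)} = U" using deg U(1) by auto
  moreover have "{e \<in> E. odd (card (e \<inter> U))} = cut E U"
  proof -
    have "odd (card (e \<inter> U)) \<longleftrightarrow> card (e \<inter> U) = 1" if "e \<in> E" for e
      using card_inter_le_2[OF G that, of U] by presburger
    then show ?thesis by (auto simp: cut_def)
  qed
  ultimately show ?thesis using U(2) even_sum_iff[OF finU] even_sum_iff[OF GD(2)] by metis
qed

lemma perfect_matching_odd_cut:
  assumes G: "simple_graph V E" and M: "perfect_matching V E M" and U: "U \<subseteq> V" "odd (card U)"
  shows "odd (card (cut M U))"
proof (rule odd_cut_of_odd_set)
  show "simple_graph V M" using G M by (auto simp: simple_graph_def perfect_matching_def)
  show "odd (degree M v)" if "v \<in> V" for v
    using M that by (simp add: perfect_matching_def regular_graph_def)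
qed (use U in auto)

lemma perfect_matching_of_pairing:
  fixes c :: "'a set \<Rightarrow> real"
  assumes G: "simple_graph V E" and m: "pairing V m" and edge: "\<And>v. v \<in> V \<Longrightarrow> {v, m v} \<in> E"
  shows "\<exists>M. perfect_matching V E M \<and> (\<Sum>v\<in>V. c {v, m v}) = 2 * (\<Sum>e\<in>M. c e)"
proof -
  note GD = simple_graphD[OF G]
  define M where "M = (\<lambda>v. {v, m v}) ` V"
  have ME: "M \<subseteq> E" using edge by (auto simp: M_def)
  have at: "{e. e \<in> M \<and> v \<in> e} = {{v, m v}}" if "v \<in> V" for v
    using that m unfolding M_def pairing_def by (auto simp: insert_commute)
  have "perfect_matching V E M"
    unfolding perfect_matching_def regular_graph_def degree_def using at ME by simp
  moreover have "(\<Sum>v\<in>V. c {v, m v}) = 2 * (\<Sum>e\<in>M. c e)"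
  proof -
    have "(\<Sum>v\<in>V. c {v, m v}) = (\<Sum>v\<in>V. \<Sum>e | e \<in> M \<and> v \<in> e. c e)" using at by simp
    also have "\<dots> = (\<Sum>e\<in>M. real (card (e \<inter> V)) * c e)"
      using GD(1,2) ME by (intro weighted_handshake) (auto intro: finite_subset)
    also have "\<dots> = (\<Sum>e\<in>M. 2 * c e)"
      using GD(3,4) ME by (intro sum.cong refl) (auto simp: Int_absorb2 subset_iff)
    finally show ?thesis by (simp add: sum_distrib_left)
  qed
  ultimately show ?thesis by blast
qed

text \<open>
  The penalty method: \<open>a\<close> is the gain and \<open>b\<close> the amount of violation of one of finitely many
  candidates. If for every price \<open>B\<close> of a violation some candidate makes no loss, then some
  candidate violates nothing and makes no loss.
\<close>

lemma large_penalty_forces_zero: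
  fixes S :: "(real \<times> real) set"
  assumes fin: "finite S" and nonneg: "\<And>a b. (a, b) \<in> S \<Longrightarrow> 0 \<le> b"
    and dom: "\<And>B. \<exists>(a, b)\<in>S. B * b \<le> a"
  shows "\<exists>a\<ge>0. (a, 0) \<in> S"
proof -
  \<comment> \<open>This price exceeds the break-even price \<open>a / b\<close> of every candidate with a violation.\<close>
  define B where "B = 1 + (\<Sum>(a, b)\<in>S. \<bar>a / b\<bar>)"
  obtain a b where ab: "(a, b) \<in> S" "B * b \<le> a" using dom[of B] by blast
  have "b = 0"
  proof (rule ccontr)
    assume "b \<noteq> 0"
    then have "b > 0" using nonneg[OF ab(1)] by simp
    then have "B \<le> a / b" using ab(2) by (simp add: pos_le_divide_eq)
    moreover have "\<bar>a / b\<bar> \<le> (\<Sum>(a, b)\<in>S. \<bar>a / b\<bar>)"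
      using member_le_sum[OF ab(1), of "\<lambda>(a, b). \<bar>a / b\<bar>"] fin by auto
    ultimately show False unfolding B_def using abs_ge_self[of "a / b"] by linarith
  qed
  then show ?thesis using ab by auto
qed

text \<open>
  Edmonds' theorem for a graph. Its edge weights, extended by zero, form a fractional pairing of
  the complete graph, and a penalty on pairs that are not edges makes the optimal pairing use
  edges of the graph only.
\<close>

lemma perfect_matching_dominates:
  fixes c :: "'a set \<Rightarrow> real"
  assumes G: "simple_graph V E" and w: "fractional_perfect_matching V E w"
  shows "\<exists>M. perfect_matching V E M \<and> (\<Sum>e\<in>E. c e * w e) \<le> (\<Sum>e\<in>M. c e)"
proof -
  note GD = simple_graphD[OF G]
  have fin: "finite V" by (rule GD(1))
  define x where "x u v = (if {u, v} \<in> E then w {u, v} else 0)" for u v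
  define a where "a u v = (if {u, v} \<in> E then c {u, v} else 0)" for u v
  define p :: "'a \<Rightarrow> 'a \<Rightarrow> real" where "p u v = (if {u, v} \<in> E then 0 else 1)" for u v
  define T where "T = 2 * (\<Sum>e\<in>E. c e * w e)"
  have row: "(\<Sum>v\<in>V. if {u, v} \<in> E then f {u, v} else 0) = (\<Sum>e | e \<in> E \<and> u \<in> e. f e)"
    if "u \<in> V" for u and f :: "'a set \<Rightarrow> real"
    using sum_over_neighbours[OF G that] .
  have x: "fractional_pairing V x"
    unfolding fractional_pairing_def
  proof (intro conjI allI ballI impI)
    fix u v show "x u v = x v u" by (simp add: x_def insert_commute)
  next
    fix u v assume "u \<in> V" "v \<in> V"
    show "0 \<le> x u v" using w by (simp add: x_def fractional_perfect_matching_def)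
  next
    fix u assume u: "u \<in> V"
    show "x u u = 0" using GD(5) by (simp add: x_def)
    show "(\<Sum>v\<in>V. x u v) = 1"
      using w u row[OF u] by (simp add: x_def fractional_perfect_matching_def)
  next
    fix U assume "U \<subseteq> V" "odd (card U)"
    then show "1 \<le> outflow x V U"
      using w outflow_of_edge_weights[OF G, of U w]
      by (simp add: x_def[abs_def] fractional_perfect_matching_def)
  qed
  have total: "(\<Sum>u\<in>V. \<Sum>v\<in>V. (a u v - B * p u v) * x u v) = T" for B
  proof -
    have "(\<Sum>u\<in>V. \<Sum>v\<in>V. (a u v - B * p u v) * x u v) =
        (\<Sum>u\<in>V. \<Sum>v\<in>V. if {u, v} \<in> E then c {u, v} * w {u, v} else 0)"
      by (intro sum.cong) (auto simp: a_def p_def x_def)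
    also have "\<dots> = (\<Sum>u\<in>V. \<Sum>e | e \<in> E \<and> u \<in> e. c e * w e)"
      using row[of _ "\<lambda>e. c e * w e"] by simp
    also have "\<dots> = (\<Sum>e\<in>E. real (card (e \<inter> V)) * (c e * w e))"
      using fin GD(2) by (rule weighted_handshake)
    also have "\<dots> = (\<Sum>e\<in>E. 2 * (c e * w e))"
      using GD(3,4) by (intro sum.cong refl) (simp add: Int_absorb2)
    finally show ?thesis by (simp add: T_def sum_distrib_left)
  qed
  define S where "S = {((\<Sum>v\<in>V. a v (m v)) - T, \<Sum>v\<in>V. p v (m v)) | m. pairing V m}"
  have "\<exists>t\<ge>0. (t, 0) \<in> S"
  proof (rule large_penalty_forces_zero)
    have "S \<subseteq> (\<lambda>t. t - T) ` {\<Sum>v\<in>V. a v (m v) | m. pairing V m} \<times>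
        {\<Sum>v\<in>V. p v (m v) | m. pairing V m}" by (auto simp: S_def)
    then show "finite S"
      by (rule finite_subset) (intro finite_SigmaI finite_imageI finite_pairing_costs fin)
    show "0 \<le> b" if "(t, b) \<in> S" for t b
      using that by (auto simp: S_def p_def intro!: sum_nonneg)
    fix B :: real
    have "a u v - B * p u v = a v u - B * p v u" for u v
      by (simp add: a_def p_def insert_commute)
    then obtain m where m: "pairing V m" "T \<le> (\<Sum>v\<in>V. a v (m v) - B * p v (m v))"
      using pairings_dominateD[OF pairings_dominate_fractional_pairings[OF fin] x,
          of "\<lambda>u v. a u v - B * p u v"] unfolding total by blast
    then have "B * (\<Sum>v\<in>V. p v (m v)) \<le> (\<Sum>v\<in>V. a v (m v)) - T"
      by (simp add: sum_subtractf sum_distrib_left)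
    then show "\<exists>(t, b)\<in>S. B * b \<le> t" using m(1) unfolding S_def by blast
  qed
  then obtain m where m: "pairing V m" "T \<le> (\<Sum>v\<in>V. a v (m v))" "(\<Sum>v\<in>V. p v (m v)) = 0"
    by (auto simp: S_def)
  have "\<forall>v\<in>V. p v (m v) = 0"
    using m(3) fin by (subst (asm) sum_nonneg_eq_0_iff) (auto simp: p_def)
  then have edge: "{v, m v} \<in> E" if "v \<in> V" for v
    using that by (auto simp: p_def split: if_splits)
  obtain M where M: "perfect_matching V E M" "(\<Sum>v\<in>V. c {v, m v}) = 2 * (\<Sum>e\<in>M. c e)"
    using perfect_matching_of_pairing[OF G m(1) edge] by blast
  have "(\<Sum>v\<in>V. a v (m v)) = (\<Sum>v\<in>V. c {v, m v})"
    using edge by (intro sum.cong) (auto simp: a_def)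
  then have "(\<Sum>e\<in>E. c e * w e) \<le> (\<Sum>e\<in>M. c e)" using m(2) M(2) by (simp add: T_def)
  then show ?thesis using M(1) by blast
qed

text \<open>
  A perfect matching crosses every odd cut at least once, so on each cut of weight one the number
  of crossings beyond the first is a valid penalty. The weights \<open>w\<close> pay nothing for it.
\<close>

lemma perfect_matching_on_tight_cuts:
  fixes c :: "'a set \<Rightarrow> real"
  assumes G: "simple_graph V E" and w: "fractional_perfect_matching V E w"
  shows "\<exists>M. perfect_matching V E M \<and> (\<Sum>e\<in>E. c e * w e) \<le> (\<Sum>e\<in>M. c e) \<and>
    (\<forall>U\<subseteq>V. odd (card U) \<longrightarrow> (\<Sum>e\<in>cut E U. w e) = 1 \<longrightarrow> card (cut M U) = 1)"
proof -
  note GD = simple_graphD[OF G]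
  define T where "T = {U. U \<subseteq> V \<and> odd (card U) \<and> (\<Sum>e\<in>cut E U. w e) = 1}"
  define excess where "excess M = (\<Sum>U\<in>T. real (card (cut M U)) - 1)" for M
  define S where "S = {((\<Sum>e\<in>M. c e) - (\<Sum>e\<in>E. c e * w e), excess M) | M.
    perfect_matching V E M}"
  have finT: "finite T" using GD(1) by (simp add: T_def)
  have pos: "1 \<le> card (cut M U)" if "perfect_matching V E M" "U \<in> T" for M U
    using perfect_matching_odd_cut[OF G that(1), of U] that(2) by (auto simp: T_def Suc_le_eq odd_pos)
  have count: "(\<Sum>e\<in>F. real (card {U \<in> T. e \<in> cut E U}) * f e) = (\<Sum>U\<in>T. \<Sum>e\<in>cut F U. f e)"
    if "F \<subseteq> E" for F and f :: "'a set \<Rightarrow> real"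
  proof -
    have "(\<Sum>e\<in>F. real (card {U \<in> T. e \<in> cut E U}) * f e) =
        (\<Sum>e\<in>F. \<Sum>U | U \<in> T \<and> e \<in> cut E U. f e)" by simp
    also have "\<dots> = (\<Sum>U\<in>T. \<Sum>e | e \<in> F \<and> e \<in> cut E U. f e)"
      using finT GD(2) that by (intro sum.swap_restrict) (auto intro: finite_subset)
    also have "\<dots> = (\<Sum>U\<in>T. \<Sum>e\<in>cut F U. f e)"
      using that by (intro sum.cong) (auto simp: cut_def)
    finally show ?thesis .
  qed
  have "\<exists>t\<ge>0. (t, 0) \<in> S"
  proof (rule large_penalty_forces_zero)
    have "S \<subseteq> (\<lambda>M. ((\<Sum>e\<in>M. c e) - (\<Sum>e\<in>E. c e * w e), excess M)) ` Pow E"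
      by (auto simp: S_def perfect_matching_def)
    then show "finite S" using GD(2) by (meson finite_Pow_iff finite_imageI finite_subset)
    show "0 \<le> b" if "(t, b) \<in> S" for t b
      using that pos by (fastforce simp: S_def excess_def intro!: sum_nonneg)
    fix B :: real
    define d where "d e = c e - B * real (card {U \<in> T. e \<in> cut E U})" for e
    obtain M where M: "perfect_matching V E M" "(\<Sum>e\<in>E. d e * w e) \<le> (\<Sum>e\<in>M. d e)"
      using perfect_matching_dominates[OF G w] by blast
    have ME: "M \<subseteq> E" using M(1) by (simp add: perfect_matching_def)
    have "(\<Sum>e\<in>M. d e) = (\<Sum>e\<in>M. c e) - B * (\<Sum>e\<in>M. real (card {U \<in> T. e \<in> cut E U}) * 1)"
      by (simp add: d_def sum_subtractf sum_distrib_left)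
    also have "\<dots> = (\<Sum>e\<in>M. c e) - B * (\<Sum>U\<in>T. real (card (cut M U)))"
      unfolding count[OF ME] by simp
    finally have 1: "(\<Sum>e\<in>M. d e) = (\<Sum>e\<in>M. c e) - B * (\<Sum>U\<in>T. real (card (cut M U)))" .
    have "(\<Sum>e\<in>E. d e * w e) = (\<Sum>e\<in>E. c e * w e) -
        B * (\<Sum>e\<in>E. real (card {U \<in> T. e \<in> cut E U}) * w e)"
      by (simp add: d_def left_diff_distrib sum_subtractf sum_distrib_left mult.assoc)
    also have "\<dots> = (\<Sum>e\<in>E. c e * w e) - B * real (card T)"
      unfolding count[OF subset_refl] by (simp add: T_def)
    finally have "B * excess M \<le> (\<Sum>e\<in>M. c e) - (\<Sum>e\<in>E. c e * w e)"
      using 1 M(2) by (simp add: excess_def sum_subtractf algebra_simps)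
    then show "\<exists>(t, b)\<in>S. B * b \<le> t" using M(1) unfolding S_def by blast
  qed
  then obtain M where M: "perfect_matching V E M" "(\<Sum>e\<in>E. c e * w e) \<le> (\<Sum>e\<in>M. c e)"
    "excess M = 0" by (auto simp: S_def)
  have "\<forall>U\<in>T. real (card (cut M U)) - 1 = 0"
    using M(3) finT pos[OF M(1)] unfolding excess_def
    by (subst (asm) sum_nonneg_eq_0_iff) (auto simp: T_def)
  then have "card (cut M U) = 1" if "U \<in> T" for U using that by force
  then show ?thesis using M(1,2) by (auto simp: T_def)
qed

section \<open>Choosing the matchings one after another\<close>

text \<open>
  In a cubic graph the cut of an odd set has odd size, and a cut of size one would be a bridge.
\<close>

lemma bridgeless_odd_cut_ge_3:
  assumes G: "simple_graph V E" and "cubic_graph V E" and bl: "bridgeless V E"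
    and U: "U \<subseteq> V" "odd (card U)"
  shows "3 \<le> card (cut E U)"
proof -
  note GD = simple_graphD[OF G]
  have "odd (card (cut E U))"
    using assms(2) by (intro odd_cut_of_odd_set[OF G U]) (simp add: regular_graph_def)
  moreover have "card (cut E U) \<noteq> 1"
  proof
    assume "card (cut E U) = 1"
    then obtain e where e: "cut E U = {e}" by (auto simp: card_1_singleton_iff)
    then have eE: "e \<in> E" by (auto simp: cut_def)
    then have con: "connected_graph V (E - {e})" using bl by (simp add: bridgeless_def)
    have "U \<noteq> {}" using U(2) by auto
    then obtain u where u: "u \<in> U" by blast
    have "card (e \<inter> U) = 1" using e by (auto simp: cut_def)
    then have "U \<noteq> V" using GD(3,4)[OF eE] by (auto simp: Int_absorb2)
    then obtain v where v: "v \<in> V" "v \<notin> U" using U(1) by blast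
    have "(u, v) \<in> (adjacency (E - {e}))\<^sup>*"
      using con u U(1) v(1) by (auto simp: connected_graph_def)
    then have "v \<in> U"
    proof (induction rule: rtrancl_induct)
      case base
      show ?case by (rule u)
    next
      case (step y z)
      then have "{y, z} \<in> E" "{y, z} \<notin> cut E U" using e by (auto simp: adjacency_def)
      then show ?case using doubleton_in_cut_iff[OF G _ step.IH] by blast
    qed
    then show False using v(2) by simp
  qed
  ultimately show ?thesis by presburger
qed

text \<open>
  The condition on odd cuts says exactly that the weights \<open>(k + 1 - n e) / (2 * k + 3)\<close>, where
  \<open>n e\<close> counts the matchings that contain \<open>e\<close>, put weight at least one on the cut. Carrying it
  through the induction is what allows the next matching to be chosen.
\<close>

lemma greedy_perfect_matchings:
  assumes G: "simple_graph V E" and cubic: "cubic_graph V E" and bl: "bridgeless V E"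
  shows "\<exists>M :: nat \<Rightarrow> 'a set set. (\<forall>i<k. perfect_matching V E (M i)) \<and>
    (\<forall>U\<subseteq>V. odd (card U) \<longrightarrow>
       2 * k + 3 + (\<Sum>i<k. card (cut (M i) U)) \<le> (k + 1) * card (cut E U)) \<and>
    real (card (E - (\<Union>i<k. M i))) \<le> (\<Prod>i<k. (real i + 2) / (2 * real i + 3)) * real (card E)"
proof (induction k)
  case 0
  show ?case using bridgeless_odd_cut_ge_3[OF G cubic bl] by simp
next
  case (Suc k)
  note GD = simple_graphD[OF G]
  obtain M :: "nat \<Rightarrow> 'a set set" where M: "\<And>i. i < k \<Longrightarrow> perfect_matching V E (M i)"
    and cuts: "\<And>U. U \<subseteq> V \<Longrightarrow> odd (card U) \<Longrightarrow>
       2 * k + 3 + (\<Sum>i<k. card (cut (M i) U)) \<le> (k + 1) * card (cut E U)"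
    and uncovered: "real (card (E - (\<Union>i<k. M i))) \<le>
       (\<Prod>i<k. (real i + 2) / (2 * real i + 3)) * real (card E)"
    using Suc.IH by blast
  have ME: "M i \<subseteq> E" if "i < k" for i using M[OF that] by (simp add: perfect_matching_def)
  define n where "n e = card {i. i < k \<and> e \<in> M i}" for e
  define w where "w e = (real k + 1 - real (n e)) / (2 * real k + 3)" for e
  have n_le: "n e \<le> k" for e
    unfolding n_def using card_mono[of "{..<k}" "{i. i < k \<and> e \<in> M i}"] by auto
  have sum_w: "(\<Sum>e\<in>A. w e) =
      ((real k + 1) * real (card A) - (\<Sum>i<k. real (card (M i \<inter> A)))) / (2 * real k + 3)"
    if "A \<subseteq> E" for A
  proof -
    have "(\<Sum>e\<in>A. \<Sum>i | i \<in> {..<k} \<and> e \<in> M i. 1) = (\<Sum>i<k. \<Sum>e | e \<in> A \<and> e \<in> M i. (1 :: real))"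
      using GD(2) that by (intro sum.swap_restrict) (auto intro: finite_subset)
    moreover have "{e. e \<in> A \<and> e \<in> M i} = M i \<inter> A" for i by blast
    ultimately have "(\<Sum>e\<in>A. real (n e)) = (\<Sum>i<k. real (card (M i \<inter> A)))"
      by (simp add: n_def)
    then show ?thesis
      by (simp add: w_def sum_divide_distrib[symmetric] sum_subtractf algebra_simps)
  qed
  have cut_w: "(\<Sum>e\<in>cut E U. w e) =
      ((real k + 1) * real (card (cut E U)) - (\<Sum>i<k. real (card (cut (M i) U)))) / (2 * real k + 3)"
    for U
  proof -
    have "M i \<inter> cut E U = cut (M i) U" if "i < k" for i using ME[OF that] by (auto simp: cut_def)
    then show ?thesis using sum_w[of "cut E U"] by (simp add: cut_def)
  qed
  have cuts_real: "2 * real k + 3 + (\<Sum>i<k. real (card (cut (M i) U))) \<le>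
      (real k + 1) * real (card (cut E U))" if "U \<subseteq> V" "odd (card U)" for U
  proof -
    have "real (2 * k + 3 + (\<Sum>i<k. card (cut (M i) U))) \<le> real ((k + 1) * card (cut E U))"
      using cuts[OF that] by (rule of_nat_mono)
    then show ?thesis by (simp add: algebra_simps)
  qed
  have w: "fractional_perfect_matching V E w"
    unfolding fractional_perfect_matching_def
  proof (intro conjI ballI allI impI)
    fix e show "0 \<le> w e" using n_le[of e] by (simp add: w_def)
  next
    fix v assume v: "v \<in> V"
    have "card (M i \<inter> {e. e \<in> E \<and> v \<in> e}) = 1" if "i < k" for i
    proof -
      have "M i \<inter> {e. e \<in> E \<and> v \<in> e} = {e \<in> M i. v \<in> e}" using ME[OF that] by blast
      then show ?thesis using M[OF that] v
        by (simp add: perfect_matching_def regular_graph_def degree_def)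
    qed
    moreover have "card {e. e \<in> E \<and> v \<in> e} = 3"
      using cubic v by (simp add: regular_graph_def degree_def)
    ultimately show "(\<Sum>e | e \<in> E \<and> v \<in> e. w e) = 1"
      using sum_w[of "{e. e \<in> E \<and> v \<in> e}"] by simp
  next
    fix U assume "U \<subseteq> V" "odd (card U)"
    then show "1 \<le> (\<Sum>e\<in>cut E U. w e)" using cuts_real[of U] by (simp add: cut_w)
  qed
  define R where "R = E - (\<Union>i<k. M i)"
  obtain N where N: "perfect_matching V E N"
    and gain: "(\<Sum>e\<in>E. of_bool (e \<in> R) * w e) \<le> (\<Sum>e\<in>N. of_bool (e \<in> R))"
    and tight: "\<And>U. U \<subseteq> V \<Longrightarrow> odd (card U) \<Longrightarrow> (\<Sum>e\<in>cut E U. w e) = 1 \<Longrightarrow> card (cut N U) = 1"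
    using perfect_matching_on_tight_cuts[OF G w, of "\<lambda>e. of_bool (e \<in> R)"] by blast
  have NE: "N \<subseteq> E" using N by (simp add: perfect_matching_def)
  have finN: "finite N" using NE GD(2) by (rule finite_subset)
  have RE: "R \<subseteq> E" by (auto simp: R_def)
  have finR: "finite R" using RE GD(2) by (rule finite_subset)
  define M' where "M' = M(k := N)"
  have "perfect_matching V E (M' i)" if "i < Suc k" for i
    using that M N by (auto simp: M'_def less_Suc_eq)
  moreover have "2 * Suc k + 3 + (\<Sum>i<Suc k. card (cut (M' i) U)) \<le> (Suc k + 1) * card (cut E U)"
    if U: "U \<subseteq> V" "odd (card U)" for U
  proof -
    define s where "s = (\<Sum>i<k. card (cut (M i) U))"
    have s': "(\<Sum>i<Suc k. card (cut (M' i) U)) = s + card (cut N U)"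
      by (simp add: M'_def s_def)
    have le: "2 * k + 3 + s \<le> (k + 1) * card (cut E U)" using cuts[OF U] by (simp add: s_def)
    have Nle: "card (cut N U) \<le> card (cut E U)"
      using NE GD(2) by (intro card_mono) (auto simp: cut_def)
    show ?thesis
    proof (cases "2 * k + 3 + s = (k + 1) * card (cut E U)")
      \<comment> \<open>The cut has weight one, so \<open>N\<close> crosses it once and the new slack is the size of the
        cut minus 3.\<close>
      case True
      then have "real (2 * k + 3 + s) = real ((k + 1) * card (cut E U))" by simp
      then have "(\<Sum>e\<in>cut E U. w e) = 1"
        unfolding cut_w by (simp add: s_def algebra_simps)
      then have "card (cut N U) = 1" using tight U by blast
      then show ?thesis
        using s' True bridgeless_odd_cut_ge_3[OF G cubic bl U] by simp
    next
      \<comment> \<open>By parity the slack is at least two, and it decreases by at most two, which happens when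
        \<open>N\<close> contains the whole cut.\<close>
      case False
      have "odd (card (cut (M i) U))" if "i < k" for i
        using perfect_matching_odd_cut[OF G M[OF that] U] .
      then have "{i \<in> {..<k}. odd (card (cut (M i) U))} = {..<k}" by auto
      moreover have "even s \<longleftrightarrow> even (card {i \<in> {..<k}. odd (card (cut (M i) U))})"
        unfolding s_def by (rule even_sum_iff) simp
      ultimately have "even s \<longleftrightarrow> even k" by (simp only: card_lessThan)
      moreover have "odd (card (cut E U))"
        using cubic by (intro odd_cut_of_odd_set[OF G U]) (simp add: regular_graph_def)
      ultimately have "even (2 * k + 3 + s) \<longleftrightarrow> even ((k + 1) * card (cut E U))" by simp
      then have "2 * k + 3 + s + 2 \<le> (k + 1) * card (cut E U)" using le False by presburger
      then show ?thesis using s' Nle by simp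
    qed
  qed
  moreover have "real (card (E - (\<Union>i<Suc k. M' i))) \<le>
      (\<Prod>i<Suc k. (real i + 2) / (2 * real i + 3)) * real (card E)"
  proof -
    have "w e = (real k + 1) / (2 * real k + 3)" if "e \<in> R" for e
    proof -
      have "{i. i < k \<and> e \<in> M i} = {}" using that by (auto simp: R_def)
      then show ?thesis by (simp add: w_def n_def)
    qed
    moreover have "(\<Sum>e\<in>E. of_bool (e \<in> R) * w e) = (\<Sum>e\<in>R. w e)"
      using GD(2) RE by (intro sum.mono_neutral_cong_right) auto
    ultimately have "(\<Sum>e\<in>E. of_bool (e \<in> R) * w e) = (real k + 1) / (2 * real k + 3) * real (card R)"
      by simp
    moreover have "(\<Sum>e\<in>N. of_bool (e \<in> R)) = real (card (N \<inter> R))"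
      using finN by (simp add: Int_def)
    ultimately have "(real k + 1) / (2 * real k + 3) * real (card R) \<le> real (card (N \<inter> R))"
      using gain by simp
    moreover have "real (card (R - N)) = real (card R) - real (card (N \<inter> R))"
      using finR card_Int_Diff[of R N] by (simp add: Int_commute)
    moreover have "(real k + 2) / (2 * real k + 3) = 1 - (real k + 1) / (2 * real k + 3)"
      by (simp add: field_simps)
    ultimately have "real (card (R - N)) \<le> (real k + 2) / (2 * real k + 3) * real (card R)"
      by (simp only: left_diff_distrib)
    also have "\<dots> \<le> (real k + 2) / (2 * real k + 3) *
        ((\<Prod>i<k. (real i + 2) / (2 * real i + 3)) * real (card E))"
      using uncovered by (intro mult_left_mono) (auto simp: R_def)
    also have "\<dots> = (\<Prod>i<Suc k. (real i + 2) / (2 * real i + 3)) * real (card E)" by simp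
    finally have "real (card (R - N)) \<le>
      (\<Prod>i<Suc k. (real i + 2) / (2 * real i + 3)) * real (card E)" .
    moreover have "E - (\<Union>i<Suc k. M' i) = R - N"
      by (auto simp: R_def M'_def less_Suc_eq)
    ultimately show ?thesis by simp
  qed
  ultimately show ?case by blast
qed

theorem corollary3p1:
  fixes V :: "'a set" and E :: "'a set set"
  assumes "simple_graph V E"
    and "connected_graph V E"
    and "cubic_graph V E"
    and "bridgeless V E"
  shows "\<exists>M :: nat \<Rightarrow> 'a set set. (\<forall>i\<in>{1..5}. perfect_matching V E (M i)) \<and>
    int (card (\<Union>i\<in>{1..5}. M i)) \<ge> \<lceil>215 / 231 * real (card E)\<rceil>"
proof -
  obtain M :: "nat \<Rightarrow> 'a set set" where M: "\<And>i. i < 5 \<Longrightarrow> perfect_matching V E (M i)"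
    and uncovered: "real (card (E - (\<Union>i<5. M i))) \<le>
      (\<Prod>i<5. (real i + 2) / (2 * real i + 3)) * real (card E)"
    using greedy_perfect_matchings[OF assms(1,3,4), of 5] by blast
  have finE: "finite E" using simple_graphD(2)[OF assms(1)] .
  have prod: "(\<Prod>i<5. (real i + 2) / (2 * real i + 3)) = 16 / 231"
    by (simp add: eval_nat_numeral)
  define C where "C = (\<Union>i<5. M i)"
  have CE: "C \<subseteq> E" using M by (auto simp: C_def perfect_matching_def)
  have "card (E - C) = card E - card C" "card C \<le> card E"
    using CE finE by (auto intro: card_Diff_subset finite_subset card_mono)
  then have "215 / 231 * real (card E) \<le> real (card C)"
    using uncovered unfolding prod C_def[symmetric] by (simp add: of_nat_diff)
  then have "\<lceil>215 / 231 * real (card E)\<rceil> \<le> int (card C)" by (simp add: ceiling_le_iff)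
  moreover have "C = (\<Union>i\<in>{1..5}. M (i - 1))"
  proof -
    have "{..<5 :: nat} = (\<lambda>i. i - 1) ` {1..5}"
      by (auto simp: image_iff intro!: bexI[of _ "Suc _"])
    then show ?thesis unfolding C_def by (simp add: image_image)
  qed
  moreover have "\<forall>i\<in>{1..5}. perfect_matching V E (M (i - 1))" using M by auto
  ultimately show ?thesis by (intro exI[of _ "\<lambda>i. M (i - 1)"]) simp
qed

end
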